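(* Let $X$ be a real Hilbert space, let $\alpha>2$, let $T\colon X\to X$ be linear and nonexpansive, and let $x_0\in X$. Then the coefficient matrix $(c_{n,k})_{(n,k)\in\mathbb{N}\times\mathbb{N}}$ of the Boţ–Nguyen acceleration with parameter $\alpha$ is regular, and the sequence $(x_n)_{n\in\mathbb{N}}$ generated by the Boţ–Nguyen acceleration converges weakly to $P_{\operatorname{Fix}T}x_0$.
   Context: $\mathbb{N}=\{0,1,2,\ldots\}$. Nonexpansive means $\|Tx-Ty\|\le\|x-y\|$ for all $x,y\in X$. $\operatorname{Fix}T=\{x\in X: Tx=x\}$ (a closed linear subspace when $T$ is linear and nonexpansive), and $P_{\operatorname{Fix}T}$ is the orthogonal projection onto it. Boţ–Nguyen acceleration: set $x_1:=x_0$ and, for every $n\ge 1$, $$x_{n+1}:=\Big(1-\frac{\alpha}{2(n+\alpha)}\Big)x_n+\frac{\alpha}{2(n+\alpha)}Tx_n+\frac{n}{n+\alpha}(Tx_n-Tx_{n-1}).$$ Coefficients: by linearity $x_{n+1}=\sum_{k=0}^{\infty}c_{n,k}T^kx_0$ for all $n\in\mathbb{N}$, where $c_{n,k}:=0$ if $n<0$ or $k<0$ or $k>n$, where $$c_{0,0}=1,\quad c_{1,0}=\frac{2+\alpha}{2(1+\alpha)},\quad c_{1,1}=\frac{\alpha}{2(1+\alpha)},$$ and for all $n\ge 2$ and $k\in\{0,\ldots,n\}$, $$c_{n,k}=\frac{2n+\alpha}{2(n+\alpha)}c_{n-1,k}+\frac{2n+\alpha}{2(n+\alpha)}c_{n-1,k-1}-\frac{n}{n+\alpha}c_{n-2,k-1}.$$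 A real matrix $(c_{n,k})_{(n,k)\in\mathbb{N}\times\mathbb{N}}$ is regular if for every convergent sequence of real numbers $(\xi_n)_{n\in\mathbb{N}}$ one has $\lim_{n}\sum_{k=0}^\infty c_{n,k}\xi_k=\lim_n\xi_n$. *)

theory Defs
  imports "HOL-Analysis.Analysis"
begin

definition nonexpansive :: "('a::real_normed_vector \<Rightarrow> 'a) \<Rightarrow> bool" where
  "nonexpansive T \<longleftrightarrow> (\<forall>x y. norm (T x - T y) \<le> norm (x - y))"

definition fixed_points :: "('a \<Rightarrow> 'a) \<Rightarrow> 'a set" where
  "fixed_points T = {x. T x = x}"

text \<open>
  The library's \<open>closest_point\<close> is restricted to spaces with the Heine--Borel property.
  The definition below is meant for a closed linear subspace of a Hilbert space, where
  the described point exists and is unique.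
\<close>
definition orthogonal_projection :: "'a::real_inner set \<Rightarrow> 'a \<Rightarrow> 'a" where
  "orthogonal_projection S x = (THE p. p \<in> S \<and> (\<forall>s\<in>S. orthogonal (x - p) s))"

lemma orthogonal_projection_eqI:
  assumes S: "subspace S" and p: "p \<in> S" "\<And>s. s \<in> S \<Longrightarrow> orthogonal (x - p) s"
  shows "orthogonal_projection S x = p"
  unfolding orthogonal_projection_def
proof (rule the_equality)
  show "p \<in> S \<and> (\<forall>s\<in>S. orthogonal (x - p) s)"
    using p by blast
next
  fix q assume q: "q \<in> S \<and> (\<forall>s\<in>S. orthogonal (x - q) s)"
  have "q - p \<in> S"
    using S p(1) q by (simp add: subspace_diff)
  then have "inner (x - p) (q - p) = 0" "inner (x - q) (q - p) = 0"
    using p(2) q by (auto simp: orthogonal_def)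
  then have "inner (q - p) (q - p) = 0"
    by (simp add: inner_diff_left)
  then show "q = p"
    by simp
qed

definition weakly_converges :: "(nat \<Rightarrow> 'a::real_inner) \<Rightarrow> 'a \<Rightarrow> bool" where
  "weakly_converges x l \<longleftrightarrow> (\<forall>y. (\<lambda>n. inner (x n) y) \<longlonglongrightarrow> inner l y)"

definition regular_matrix :: "(nat \<Rightarrow> nat \<Rightarrow> real) \<Rightarrow> bool" where
  "regular_matrix c \<longleftrightarrow>
     (\<forall>\<xi> l. \<xi> \<longlonglongrightarrow> l \<longrightarrow>
        (\<forall>n. summable (\<lambda>k. c n k * \<xi> k)) \<and> (\<lambda>n. \<Sum>k. c n k * \<xi> k) \<longlonglongrightarrow> l)"

fun bn_seq :: "real \<Rightarrow> ('a::real_vector \<Rightarrow> 'a) \<Rightarrow> 'a \<Rightarrow> nat \<Rightarrow> 'a" where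
  "bn_seq \<alpha> T x0 0 = x0"
| "bn_seq \<alpha> T x0 (Suc 0) = x0"
| "bn_seq \<alpha> T x0 (Suc (Suc m)) =
     (let n = real (Suc m); x = bn_seq \<alpha> T x0 (Suc m); x' = bn_seq \<alpha> T x0 m
      in (1 - \<alpha> / (2 * (n + \<alpha>))) *\<^sub>R x + (\<alpha> / (2 * (n + \<alpha>))) *\<^sub>R T x
           + (n / (n + \<alpha>)) *\<^sub>R (T x - T x'))"

text \<open>
  The row \<open>n\<close> holds the coefficients of \<open>bn_seq \<alpha> T x0 (Suc n)\<close> (see \<open>bn_seq_Suc_eq_sum\<close>).
  The entries with column index \<open>-1\<close> in the recurrence, which vanish by convention,
  appear as the explicit case \<open>k = 0\<close>.
\<close>
fun bn_coeff :: "real \<Rightarrow> nat \<Rightarrow> nat \<Rightarrow> real" where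
  "bn_coeff \<alpha> 0 k = (if k = 0 then 1 else 0)"
| "bn_coeff \<alpha> (Suc 0) k =
     (if k = 0 then (2 + \<alpha>) / (2 * (1 + \<alpha>))
      else if k = 1 then \<alpha> / (2 * (1 + \<alpha>))
      else 0)"
| "bn_coeff \<alpha> (Suc (Suc m)) k =
     (if k > Suc (Suc m) then 0
      else let n = real (Suc (Suc m))
        in (2 * n + \<alpha>) / (2 * (n + \<alpha>)) * bn_coeff \<alpha> (Suc m) k
           + (2 * n + \<alpha>) / (2 * (n + \<alpha>)) * (if k = 0 then 0 else bn_coeff \<alpha> (Suc m) (k - 1))
           - n / (n + \<alpha>) * (if k = 0 then 0 else bn_coeff \<alpha> m (k - 1)))"

lemma bn_coeff_eq_0: "k > n \<Longrightarrow> bn_coeff \<alpha> n k = 0"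
  by (induction \<alpha> n k rule: bn_coeff.induct) auto

lemma bn_seq_Suc_eq_sum:
  fixes T :: "'a::real_vector \<Rightarrow> 'a"
  assumes "linear T" and "\<alpha> > 0"
  shows "bn_seq \<alpha> T x0 (Suc n) = (\<Sum>k\<le>n. bn_coeff \<alpha> n k *\<^sub>R (T ^^ k) x0)"
proof (induction n rule: less_induct)
  case (less n)
  define e where "e k = (T ^^ k) x0" for k
  have Te: "T (\<Sum>k\<le>i. bn_coeff \<alpha> i k *\<^sub>R e k)
      = (\<Sum>k\<le>N. (if k = 0 then 0 else bn_coeff \<alpha> i (k - 1)) *\<^sub>R e k)" if "Suc i \<le> N" for i N
  proof -
    have "T (\<Sum>k\<le>i. bn_coeff \<alpha> i k *\<^sub>R e k) = (\<Sum>k\<le>i. bn_coeff \<alpha> i k *\<^sub>R e (Suc k))"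
      using assms(1) by (simp add: linear_sum linear_scale e_def)
    also have "\<dots> = (\<Sum>k\<le>Suc i. (if k = 0 then 0 else bn_coeff \<alpha> i (k - 1)) *\<^sub>R e k)"
      by (subst sum.atMost_Suc_shift) simp
    also have "\<dots> = (\<Sum>k\<le>N. (if k = 0 then 0 else bn_coeff \<alpha> i (k - 1)) *\<^sub>R e k)"
      using that by (intro sum.mono_neutral_left) (auto simp: bn_coeff_eq_0)
    finally show ?thesis .
  qed
  have ext: "(\<Sum>k\<le>i. bn_coeff \<alpha> i k *\<^sub>R e k) = (\<Sum>k\<le>N. bn_coeff \<alpha> i k *\<^sub>R e k)" if "i \<le> N" for i N
    using that by (intro sum.mono_neutral_left) (auto simp: bn_coeff_eq_0)
  consider "n = 0" | "n = 1" | m where "n = Suc (Suc m)"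
    by (metis One_nat_def not0_implies_Suc)
  then show ?case
  proof cases
    case 1
    then show ?thesis by simp
  next
    case 2
    have "1 - \<alpha> / (2 * (1 + \<alpha>)) = (2 + \<alpha>) / (2 * (1 + \<alpha>))"
      using assms(2) by (simp add: field_simps)
    with 2 show ?thesis
      by simp
  next
    case 3
    define r where "r = real n"
    define a where "a = (2 * r + \<alpha>) / (2 * (r + \<alpha>))"
    define b where "b = r / (r + \<alpha>)"
    have r: "r = real (Suc (Suc m))"
      by (simp add: r_def 3)
    have "r + \<alpha> > 0"
      using assms(2) by (simp add: r_def add_nonneg_pos)
    then have ab: "1 - \<alpha> / (2 * (r + \<alpha>)) = a" "\<alpha> / (2 * (r + \<alpha>)) + b = a"
      using \<open>r + \<alpha> > 0\<close> by (auto simp: a_def b_def divide_simps) (auto simp: algebra_simps)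
    define x where "x = bn_seq \<alpha> T x0 (Suc (Suc m))"
    define x' where "x' = bn_seq \<alpha> T x0 (Suc m)"
    have x: "x = (\<Sum>k\<le>Suc m. bn_coeff \<alpha> (Suc m) k *\<^sub>R e k)"
      unfolding x_def e_def using less[of "Suc m"] 3 by simp
    have x': "x' = (\<Sum>k\<le>m. bn_coeff \<alpha> m k *\<^sub>R e k)"
      unfolding x'_def e_def using less[of m] 3 by simp
    have "bn_seq \<alpha> T x0 (Suc n)
        = (1 - \<alpha> / (2 * (r + \<alpha>))) *\<^sub>R x + (\<alpha> / (2 * (r + \<alpha>))) *\<^sub>R T x + b *\<^sub>R (T x - T x')"
      by (simp only: 3 bn_seq.simps(3) Let_def x_def x'_def b_def r)
    also have "\<dots> = a *\<^sub>R x + (\<alpha> / (2 * (r + \<alpha>)) + b) *\<^sub>R T x - b *\<^sub>R T x'"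
      unfolding ab(1) by (simp add: algebra_simps)
    also have "\<dots> = a *\<^sub>R x + a *\<^sub>R T x - b *\<^sub>R T x'"
      by (simp only: ab)
    also have "x = (\<Sum>k\<le>n. bn_coeff \<alpha> (Suc m) k *\<^sub>R e k)"
      unfolding x by (rule ext) (simp add: 3)
    also have "T (\<Sum>k\<le>n. bn_coeff \<alpha> (Suc m) k *\<^sub>R e k)
        = (\<Sum>k\<le>n. (if k = 0 then 0 else bn_coeff \<alpha> (Suc m) (k - 1)) *\<^sub>R e k)"
      by (subst ext[symmetric], simp add: 3, rule Te) (simp add: 3)
    also have "T x' = (\<Sum>k\<le>n. (if k = 0 then 0 else bn_coeff \<alpha> m (k - 1)) *\<^sub>R e k)"
      unfolding x' by (rule Te) (simp add: 3)
    also have "a *\<^sub>R (\<Sum>k\<le>n. bn_coeff \<alpha> (Suc m) k *\<^sub>R e k)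
        + a *\<^sub>R (\<Sum>k\<le>n. (if k = 0 then 0 else bn_coeff \<alpha> (Suc m) (k - 1)) *\<^sub>R e k)
        - b *\<^sub>R (\<Sum>k\<le>n. (if k = 0 then 0 else bn_coeff \<alpha> m (k - 1)) *\<^sub>R e k)
        = (\<Sum>k\<le>n. (a * bn_coeff \<alpha> (Suc m) k
            + a * (if k = 0 then 0 else bn_coeff \<alpha> (Suc m) (k - 1))
            - b * (if k = 0 then 0 else bn_coeff \<alpha> m (k - 1))) *\<^sub>R e k)"
      by (simp only: scaleR_sum_right scaleR_scaleR sum.distrib sum_subtractf
          scaleR_left_distrib scaleR_left_diff_distrib)
    also have "\<dots> = (\<Sum>k\<le>n. bn_coeff \<alpha> n k *\<^sub>R e k)"
      by (intro sum.cong refl arg_cong2[where f = scaleR])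
        (simp only: 3 bn_coeff.simps(3) Let_def a_def b_def r atMost_iff not_less[symmetric] if_False)
    finally show ?thesis
      by (simp add: e_def)
  qed
qed

end

theory Submission
  imports Defs
begin

text \<open>
  The iteration is a persistent random walk in disguise. Write
  \<open>h\<^sub>n = \<alpha> / (2 (n + \<alpha>))\<close>, which lies in \<open>(0, 1/2)\<close> for \<open>n > 0\<close>, and let
  \<open>u\<^sub>0 = x\<^sub>0\<close>, \<open>v\<^sub>0 = 0\<close>,
  \<open>u\<^sub>n = (1 - h\<^sub>n) u\<^sub>n\<^sub>-\<^sub>1 + h\<^sub>n T v\<^sub>n\<^sub>-\<^sub>1\<close> and
  \<open>v\<^sub>n = (1 - h\<^sub>n) T v\<^sub>n\<^sub>-\<^sub>1 + h\<^sub>n u\<^sub>n\<^sub>-\<^sub>1\<close>.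
  Then \<open>x\<^sub>n = u\<^sub>n + v\<^sub>n\<close> and \<open>x\<^sub>n\<^sub>+\<^sub>1 = u\<^sub>n + T v\<^sub>n\<close>. A walker is either at rest (weight \<open>u\<close>)
  or moving (weight \<open>v\<close>), applies \<open>T\<close> once per time step while moving, and changes its
  mode at time \<open>n\<close> with probability \<open>h\<^sub>n\<close>; the coefficient \<open>c\<^sub>n\<^sub>,\<^sub>k\<close> is the probability
  of having made \<open>k\<close> moves. The negative term in the two-term recurrence for
  \<open>c\<^sub>n\<^sub>,\<^sub>k\<close> hides this nonnegativity; the two modes reveal it.

  For the matrix, the rows are probability vectors by this description. As \<open>\<Sum>h\<^sub>n\<close> diverges, the walker
  almost surely switches modes infinitely often, so each column tends to zero; this is an induction over
  columns with an averaging lemma (\<open>averaging_tendsto_zero\<close>). Regularity is then the easy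
  direction of the Silverman--Toeplitz theorem for nonnegative matrices.

  For the sequence, a mode change contracts: the energy \<open>\<parallel>u\<parallel>\<^sup>2 + \<parallel>v\<parallel>\<^sup>2\<close> drops in each step
  by at least \<open>2 h\<^sub>n (1 - h\<^sub>n) \<parallel>u - T v\<parallel>\<^sup>2\<close>. Because \<open>\<Sum>h\<^sub>n = \<infinity>\<close>, the difference \<open>u - T v\<close> is
  small at two consecutive times again and again; there \<open>u - v\<close> is small too, and hence
  so are \<open>v - T v\<close> and \<open>u - T u\<close>. Since \<open>u\<close> and \<open>v\<close> depend linearly on the starting point
  and commute with \<open>T\<close>, the quantity \<open>\<parallel>u - T u\<parallel>\<^sup>2 + \<parallel>v - T v\<parallel>\<^sup>2\<close> is itself an energy and so
  decreases; being small repeatedly, it tends to zero (\<open>bn_seq_diff_tendsto_zero\<close>).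
  The conclusion follows as in von Neumann's mean ergodic theorem: the space splits
  orthogonally into the fixed points, on which the iteration is constant, and the closure of
  the range of \<open>I - T\<close>, on which it tends to zero. The convergence is even in norm.
\<close>

section \<open>Descent and averaging with divergent step sizes\<close>

text \<open>
  The total descent is finite and bounds \<open>\<Sum>h\<^sub>n b\<^sub>n\<close>, so \<open>b\<close> cannot stay away from zero.
\<close>
lemma descent_small_infinitely_often:
  fixes G h b :: "nat \<Rightarrow> real"
  assumes descent: "\<And>n. n \<ge> N \<Longrightarrow> G (Suc n) \<le> G n - h n * b n"
    and G: "\<And>n. 0 \<le> G n" and h: "\<And>n. 0 \<le> h n" and div: "\<not> summable h" and e: "e > 0"
  shows "\<exists>n\<ge>N. b n < e"
proof (rule ccontr)
  assume "\<not> (\<exists>n\<ge>N. b n < e)"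
  then have be: "e \<le> b n" if "n \<ge> N" for n
    using that by force
  have partial: "e * (\<Sum>i<m. h (i + N)) \<le> G N - G (m + N)" for m
  proof (induction m)
    case (Suc m)
    have "e * h (m + N) \<le> h (m + N) * b (m + N)"
      using mult_left_mono[OF be h, of "m + N" "m + N"] by (simp add: mult.commute)
    with Suc descent[of "m + N"] show ?case
      by (simp add: distrib_left)
  qed simp
  have "(\<Sum>i<m. h (i + N)) \<le> G N / e" for m
    using partial[of m] G[of "m + N"] e by (simp add: field_simps)
  then have "summable (\<lambda>i. h (i + N))"
    by (intro summableI_nonneg_bounded) (auto intro: h)
  with div show False
    by simp
qed

text \<open>
  Where \<open>b \<le> \<epsilon>\<close>, the excess of \<open>a\<close> over \<open>\<epsilon>\<close> descends in the sense of the previous lemma.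
\<close>
lemma averaging_tendsto_zero:
  fixes a b h :: "nat \<Rightarrow> real"
  assumes step: "\<And>n. a (Suc n) = (1 - h n) * a n + h n * b n"
    and h: "\<And>n. 0 \<le> h n" "\<And>n. h n \<le> 1" and div: "\<not> summable h"
    and a: "\<And>n. 0 \<le> a n" and b: "b \<longlonglongrightarrow> 0"
  shows "a \<longlonglongrightarrow> 0"
proof (rule LIMSEQ_I)
  fix r :: real assume "0 < r"
  define e where "e = r / 2"
  have e: "e > 0" using \<open>0 < r\<close> by (simp add: e_def)
  from order_tendstoD(2)[OF b e] obtain N where bN: "b n < e" if "n \<ge> N" for n
    by (auto simp: eventually_sequentially)
  define G where "G n = max 0 (a n - e)" for n
  have descent: "G (Suc n) \<le> G n - h n * G n" if "n \<ge> N" for n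
  proof -
    have "a (Suc n) - e = (1 - h n) * (a n - e) + h n * (b n - e)"
      by (simp add: step algebra_simps)
    also have "\<dots> \<le> (1 - h n) * G n + h n * 0"
      using h bN[OF that] by (intro add_mono mult_left_mono) (auto simp: G_def)
    finally have "a (Suc n) - e \<le> (1 - h n) * G n" by simp
    moreover have "0 \<le> (1 - h n) * G n" using h by (simp add: G_def)
    ultimately show ?thesis by (simp add: G_def algebra_simps)
  qed
  obtain M where M: "M \<ge> N" "G M < e"
    using descent_small_infinitely_often[OF descent _ h(1) div e, of N] by (auto simp: G_def)
  have "G n < e" if "n \<ge> M" for n
    using that
  proof (induction n rule: dec_induct)
    case (step n)
    have "0 \<le> h n * G n" using h by (simp add: G_def)
    with descent[of n] step M show ?case by linarith
  qed (rule M)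
  then have "a n < e + e" if "n \<ge> M" for n
    using that by (fastforce simp: G_def)
  then have "norm (a n - 0) < r" if "n \<ge> M" for n
    using that a[of n] by (simp add: e_def)
  then show "\<exists>no. \<forall>n\<ge>no. norm (a n - 0) < r" by blast
qed

definition switch_prob :: "real \<Rightarrow> nat \<Rightarrow> real" where
  "switch_prob \<alpha> n = \<alpha> / (2 * (real n + \<alpha>))"

lemma switch_prob_bounds:
  assumes "\<alpha> > 0"
  shows "0 \<le> switch_prob \<alpha> n" "switch_prob \<alpha> n \<le> 1 / 2"
  using assms by (auto simp: switch_prob_def field_simps)

lemma switch_prob_Suc_le: "\<alpha> > 0 \<Longrightarrow> switch_prob \<alpha> (Suc n) \<le> switch_prob \<alpha> n"
  unfolding switch_prob_def by (intro divide_left_mono) auto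

lemma switch_prob_not_summable:
  assumes "\<alpha> > 0"
  shows "\<not> summable (\<lambda>n. switch_prob \<alpha> (Suc n))"
proof
  assume "summable (\<lambda>n. switch_prob \<alpha> (Suc n))"
  then have "summable (\<lambda>n. 2 * (1 + \<alpha>) / \<alpha> * switch_prob \<alpha> (Suc n))"
    by (rule summable_mult)
  moreover have "norm (inverse (real (Suc n))) \<le> 2 * (1 + \<alpha>) / \<alpha> * switch_prob \<alpha> (Suc n)" for n
  proof -
    define D where "D = real (Suc n) + \<alpha>"
    have "D > 0" using assms by (simp add: D_def)
    then have eq: "2 * (1 + \<alpha>) / \<alpha> * switch_prob \<alpha> (Suc n) = (1 + \<alpha>) / D"
      unfolding switch_prob_def D_def[symmetric] using assms by (simp add: field_simps)
    have "D \<le> (1 + \<alpha>) * real (Suc n)"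
      using assms by (simp add: D_def algebra_simps)
    then have "norm (inverse (real (Suc n))) \<le> (1 + \<alpha>) / D"
      using \<open>D > 0\<close> by (simp add: field_simps)
    then show ?thesis by (simp only: eq)
  qed
  ultimately have "summable (\<lambda>n. inverse (real (Suc n)))"
    by (rule summable_comparison_test'[where N = 0])
  then show False
    using not_summable_harmonic[where 'a = real]
      summable_Suc_iff[of "\<lambda>n. inverse (real n)"] by simp
qed

lemma bn_weights:
  assumes "\<alpha> > 0"
  shows "(2 * real n + \<alpha>) / (2 * (real n + \<alpha>)) = 1 - switch_prob \<alpha> n"
    and "real n / (real n + \<alpha>) = 1 - 2 * switch_prob \<alpha> n"
  using assms add_nonneg_pos[of "real n" \<alpha>] by (auto simp: switch_prob_def field_simps)

section \<open>The coefficient matrix\<close>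

text \<open>
  Probability of being at rest, respectively moving, just after the \<open>n\<close>-th possible mode
  change, having made \<open>k\<close> moves.
\<close>
fun rest_coeff move_coeff :: "real \<Rightarrow> nat \<Rightarrow> nat \<Rightarrow> real" where
  "rest_coeff \<alpha> 0 k = (if k = 0 then 1 else 0)"
| "move_coeff \<alpha> 0 k = 0"
| "rest_coeff \<alpha> (Suc n) k =
     (1 - switch_prob \<alpha> (Suc n)) * rest_coeff \<alpha> n k
     + switch_prob \<alpha> (Suc n) * (if k = 0 then 0 else move_coeff \<alpha> n (k - 1))"
| "move_coeff \<alpha> (Suc n) k =
     (1 - switch_prob \<alpha> (Suc n)) * (if k = 0 then 0 else move_coeff \<alpha> n (k - 1))
     + switch_prob \<alpha> (Suc n) * rest_coeff \<alpha> n k"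

lemma rest_move_coeff_nonneg:
  assumes "\<alpha> > 0"
  shows "0 \<le> rest_coeff \<alpha> n k \<and> 0 \<le> move_coeff \<alpha> n k"
proof (induction n arbitrary: k)
  case (Suc n)
  have "0 \<le> 1 - switch_prob \<alpha> (Suc n)"
    using switch_prob_bounds(2)[OF assms, of "Suc n"] by simp
  with Suc switch_prob_bounds(1)[OF assms] show ?case
    by (auto simp del: of_nat_Suc intro!: add_nonneg_nonneg mult_nonneg_nonneg)
qed simp

text \<open>
  The two-term recurrence for the coefficients arises from the two-mode walk by
  elimination: both \<open>c\<^sub>n\<close> and \<open>c\<^sub>n\<^sub>-\<^sub>1\<close> are sums of the same two modes at time \<open>n\<close>, with and
  without the pending move.
\<close>
lemma bn_coeff_eq_rest_move:
  assumes "\<alpha> > 0"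
  shows "bn_coeff \<alpha> n k
    = rest_coeff \<alpha> n k + (if k = 0 then 0 else move_coeff \<alpha> n (k - 1))"
proof (induction n arbitrary: k rule: less_induct)
  case (less n)
  consider "n = 0" | "n = 1" | m where "n = Suc (Suc m)"
    by (metis One_nat_def not0_implies_Suc)
  then show ?case
  proof cases
    case 1
    then show ?thesis by simp
  next
    case 2
    then show ?thesis
      using bn_weights(1)[OF assms, of 1] by (auto simp: switch_prob_def)
  next
    case 3
    define h where "h = switch_prob \<alpha> n"
    have w: "(2 * real n + \<alpha>) / (2 * (real n + \<alpha>)) = 1 - h" "real n / (real n + \<alpha>) = 1 - 2 * h"
      using bn_weights[OF assms, of n] by (simp_all add: h_def)
    have rec: "bn_coeff \<alpha> n k = (1 - h) * bn_coeff \<alpha> (Suc m) k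
        + (1 - h) * (if k = 0 then 0 else bn_coeff \<alpha> (Suc m) (k - 1))
        - (1 - 2 * h) * (if k = 0 then 0 else bn_coeff \<alpha> m (k - 1))"
    proof (cases "k > n")
      case True
      then show ?thesis by (simp add: bn_coeff_eq_0 3)
    next
      case False
      then show ?thesis
        unfolding w[symmetric] by (simp only: 3 bn_coeff.simps(3) Let_def if_False)
    qed
    have cur: "bn_coeff \<alpha> (Suc m) j
        = rest_coeff \<alpha> (Suc m) j + (if j = 0 then 0 else move_coeff \<alpha> (Suc m) (j - 1))" for j
      using less[of "Suc m"] 3 by simp
    have prev: "bn_coeff \<alpha> m j = rest_coeff \<alpha> (Suc m) j + move_coeff \<alpha> (Suc m) j" for j
      using less[of m j] 3 by (simp add: algebra_simps)
    have step: "rest_coeff \<alpha> n j = (1 - h) * rest_coeff \<alpha> (Suc m) j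
        + h * (if j = 0 then 0 else move_coeff \<alpha> (Suc m) (j - 1))"
      "move_coeff \<alpha> n j = (1 - h) * (if j = 0 then 0 else move_coeff \<alpha> (Suc m) (j - 1))
        + h * rest_coeff \<alpha> (Suc m) j" for j
      unfolding h_def 3 by (rule rest_coeff.simps move_coeff.simps)+
    then show ?thesis
      unfolding rec cur prev
      by (cases k) (simp_all del: rest_coeff.simps move_coeff.simps add: step algebra_simps)
  qed
qed

lemma bn_coeff_nonneg: "\<alpha> > 0 \<Longrightarrow> 0 \<le> bn_coeff \<alpha> n k"
  using rest_move_coeff_nonneg by (simp add: bn_coeff_eq_rest_move)

text \<open>For \<open>T = I\<close> on the real line, the iteration is constant and its values are the row sums.\<close>
lemma bn_coeff_row_sum:
  assumes "\<alpha> > 0"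
  shows "(\<Sum>k\<le>n. bn_coeff \<alpha> n k) = 1"
proof -
  have "bn_seq \<alpha> (\<lambda>x. x) (1 :: real) m = 1" for m
    by (induction \<alpha> "\<lambda>x::real. x" "1::real" m rule: bn_seq.induct) (auto simp: Let_def)
  moreover have "((\<lambda>x. x) ^^ k) (1 :: real) = 1" for k
    by (induction k) auto
  moreover have "linear (\<lambda>x::real. x)"
    by (rule linear_ident)
  ultimately show ?thesis
    using bn_seq_Suc_eq_sum[of "\<lambda>x::real. x" \<alpha> 1 n] assms by simp
qed

text \<open>
  In column \<open>k\<close>, the weight at rest is repeatedly averaged with the moving weight of column
  \<open>k - 1\<close>, and the moving weight of column \<open>k\<close> is a combination of these two.
\<close>
lemma rest_move_coeff_tendsto_zero:
  assumes "\<alpha> > 0"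
  shows "(\<lambda>n. rest_coeff \<alpha> n k) \<longlonglongrightarrow> 0 \<and> (\<lambda>n. move_coeff \<alpha> n k) \<longlonglongrightarrow> 0"
proof (induction k)
  have h: "0 \<le> switch_prob \<alpha> n" "switch_prob \<alpha> n \<le> 1" for n
    using switch_prob_bounds[OF assms, of n] by auto
  have column: "(\<lambda>n. rest_coeff \<alpha> n k) \<longlonglongrightarrow> 0 \<and> (\<lambda>n. move_coeff \<alpha> n k) \<longlonglongrightarrow> 0"
    if b: "(\<lambda>n. if k = 0 then 0 else move_coeff \<alpha> n (k - 1)) \<longlonglongrightarrow> 0" (is "?b \<longlonglongrightarrow> 0") for k
  proof
    show rest: "(\<lambda>n. rest_coeff \<alpha> n k) \<longlonglongrightarrow> 0"
      by (rule averaging_tendsto_zero[OF rest_coeff.simps(2) _ _ switch_prob_not_summable[OF assms] _ b])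
        (use h rest_move_coeff_nonneg[OF assms] in auto)
    have b_nonneg: "0 \<le> ?b n" for n
      using rest_move_coeff_nonneg[OF assms] by auto
    have "(\<lambda>n. ?b n + rest_coeff \<alpha> n k) \<longlonglongrightarrow> 0"
      using tendsto_add[OF b rest] by simp
    moreover have "norm (move_coeff \<alpha> (Suc n) k) \<le> ?b n + rest_coeff \<alpha> n k" for n
    proof -
      have "move_coeff \<alpha> (Suc n) k \<le> 1 * ?b n + 1 * rest_coeff \<alpha> n k"
        unfolding move_coeff.simps(2)
        using h[of "Suc n"] b_nonneg[of n] rest_move_coeff_nonneg[OF assms, of n k]
        by (intro add_mono mult_right_mono) auto
      then show ?thesis
        using rest_move_coeff_nonneg[OF assms, of "Suc n" k] by simp
    qed
    ultimately have "(\<lambda>n. move_coeff \<alpha> (Suc n) k) \<longlonglongrightarrow> 0"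
      by (intro Lim_null_comparison[where f = "\<lambda>n. move_coeff \<alpha> (Suc n) k"] always_eventually allI)
    then show "(\<lambda>n. move_coeff \<alpha> n k) \<longlonglongrightarrow> 0"
      by (rule LIMSEQ_imp_Suc)
  qed
  case 0
  show ?case by (rule column) simp
  case (Suc k)
  then show ?case by (intro column) simp
qed

lemma bn_coeff_column_tendsto_zero:
  assumes "\<alpha> > 0"
  shows "(\<lambda>n. bn_coeff \<alpha> n k) \<longlonglongrightarrow> 0"
  unfolding bn_coeff_eq_rest_move[OF assms]
  using rest_move_coeff_tendsto_zero[OF assms] by (cases k) (auto intro: tendsto_add_zero)

text \<open>
  A row sum against \<open>\<xi> - l\<close> splits into finitely many columns, each of which tends to zero,
  and a remainder in which \<open>\<xi>\<close> is close to \<open>l\<close> and the row has mass at most one.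
\<close>
lemma regular_matrix_if_stochastic:
  fixes c :: "nat \<Rightarrow> nat \<Rightarrow> real"
  assumes supp: "\<And>n k. k > n \<Longrightarrow> c n k = 0" and nonneg: "\<And>n k. 0 \<le> c n k"
    and row: "\<And>n. (\<Sum>k\<le>n. c n k) = 1" and col: "\<And>k. (\<lambda>n. c n k) \<longlonglongrightarrow> 0"
  shows "regular_matrix c"
  unfolding regular_matrix_def
proof (intro allI impI)
  fix \<xi> :: "nat \<Rightarrow> real" and l :: real
  assume \<xi>: "\<xi> \<longlonglongrightarrow> l"
  have sums: "(\<lambda>k. c n k * \<xi> k) sums (\<Sum>k\<le>n. c n k * \<xi> k)" for n
    by (rule sums_finite) (auto simp: supp)
  have "(\<lambda>n. \<Sum>k\<le>n. c n k * \<xi> k) \<longlonglongrightarrow> l"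
  proof (rule LIMSEQ_I)
    fix r :: real assume "0 < r"
    then obtain K where K: "norm (\<xi> k - l) < r / 2" if "k \<ge> K" for k
      using LIMSEQ_D[OF \<xi>, of "r / 2"] by auto
    have "(\<lambda>n. \<Sum>k<K. c n k * \<bar>\<xi> k - l\<bar>) \<longlonglongrightarrow> 0"
      by (intro tendsto_null_sum tendsto_mult_left_zero col)
    then obtain N where N: "(\<Sum>k<K. c n k * \<bar>\<xi> k - l\<bar>) < r / 2" if "n \<ge> N" for n
      using order_tendstoD(2)[of _ "0::real" sequentially "r / 2"] \<open>0 < r\<close>
      by (auto simp: eventually_sequentially)
    have "norm ((\<Sum>k\<le>n. c n k * \<xi> k) - l) < r" if "n \<ge> max N K" for n
    proof -
      have "(\<Sum>k\<le>n. c n k * \<xi> k) - l = (\<Sum>k\<le>n. c n k * \<xi> k) - (\<Sum>k\<le>n. c n k) * l"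
        by (simp add: row)
      also have "\<dots> = (\<Sum>k\<le>n. c n k * (\<xi> k - l))"
        by (simp add: sum_distrib_right sum_subtractf right_diff_distrib)
      finally have "norm ((\<Sum>k\<le>n. c n k * \<xi> k) - l) \<le> (\<Sum>k\<le>n. norm (c n k * (\<xi> k - l)))"
        by (simp only: norm_sum)
      also have "\<dots> = (\<Sum>k\<le>n. c n k * \<bar>\<xi> k - l\<bar>)"
        by (simp add: abs_mult nonneg)
      also have "\<dots> = (\<Sum>k\<in>{..<K} \<union> {K..n}. c n k * \<bar>\<xi> k - l\<bar>)"
        using that by (intro sum.cong) auto
      also have "\<dots> = (\<Sum>k<K. c n k * \<bar>\<xi> k - l\<bar>) + (\<Sum>k=K..n. c n k * \<bar>\<xi> k - l\<bar>)"
        by (rule sum.union_disjoint) auto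
      also have "(\<Sum>k=K..n. c n k * \<bar>\<xi> k - l\<bar>) \<le> (\<Sum>k=K..n. c n k * (r / 2))"
        using K by (intro sum_mono mult_left_mono nonneg) (auto intro: less_imp_le)
      also have "\<dots> \<le> (\<Sum>k\<le>n. c n k * (r / 2))"
        using \<open>0 < r\<close> by (intro sum_mono2) (auto simp: nonneg)
      also have "\<dots> = r / 2"
        using row[of n] by (simp only: sum_distrib_right[symmetric] mult_1)
      finally show ?thesis
        using N[of n] that by simp
    qed
    then show "\<exists>no. \<forall>n\<ge>no. norm ((\<Sum>k\<le>n. c n k * \<xi> k) - l) < r" by blast
  qed
  then show "(\<forall>n. summable (\<lambda>k. c n k * \<xi> k)) \<and> (\<lambda>n. \<Sum>k. c n k * \<xi> k) \<longlonglongrightarrow> l"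
    unfolding sums_unique[OF sums, symmetric] using sums by (blast intro: sums_summable)
qed

section \<open>Asymptotic regularity of the iteration\<close>

fun rest_part move_part :: "real \<Rightarrow> ('a::real_vector \<Rightarrow> 'a) \<Rightarrow> nat \<Rightarrow> 'a \<Rightarrow> 'a" where
  "rest_part \<alpha> T 0 x = x"
| "move_part \<alpha> T 0 x = 0"
| "rest_part \<alpha> T (Suc n) x = (1 - switch_prob \<alpha> (Suc n)) *\<^sub>R rest_part \<alpha> T n x
     + switch_prob \<alpha> (Suc n) *\<^sub>R T (move_part \<alpha> T n x)"
| "move_part \<alpha> T (Suc n) x = (1 - switch_prob \<alpha> (Suc n)) *\<^sub>R T (move_part \<alpha> T n x)
     + switch_prob \<alpha> (Suc n) *\<^sub>R rest_part \<alpha> T n x"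

lemma bn_seq_eq_rest_move:
  assumes "\<alpha> > 0" "linear T"
  shows "bn_seq \<alpha> T x n = rest_part \<alpha> T n x + move_part \<alpha> T n x
    \<and> bn_seq \<alpha> T x (Suc n) = rest_part \<alpha> T n x + T (move_part \<alpha> T n x)"
proof (induction n)
  case 0
  then show ?case using assms(2) by (simp add: linear_0)
next
  case (Suc n)
  define h where "h = switch_prob \<alpha> (Suc n)"
  define u where "u = rest_part \<alpha> T n x"
  define v where "v = move_part \<alpha> T n x"
  have h: "\<alpha> / (2 * (real (Suc n) + \<alpha>)) = h" "real (Suc n) / (real (Suc n) + \<alpha>) = (1 - h) - h"
    using bn_weights(2)[OF assms(1), of "Suc n"] by (simp_all add: h_def switch_prob_def)
  have uv: "rest_part \<alpha> T (Suc n) x = (1 - h) *\<^sub>R u + h *\<^sub>R T v"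
    "move_part \<alpha> T (Suc n) x = (1 - h) *\<^sub>R T v + h *\<^sub>R u"
    by (simp_all add: h_def u_def v_def)
  have prev: "bn_seq \<alpha> T x n = u + v" "bn_seq \<alpha> T x (Suc n) = u + T v"
    using Suc by (simp_all add: u_def v_def)
  have mix: "g *\<^sub>R (u + T v) + h *\<^sub>R T (u + T v) + (g - h) *\<^sub>R (T (u + T v) - T (u + v))
      = g *\<^sub>R u + h *\<^sub>R T v + T (g *\<^sub>R T v + h *\<^sub>R u)" for g
    by (simp add: linear_add[OF assms(2)] linear_scale[OF assms(2)] algebra_simps)
  have "bn_seq \<alpha> T x (Suc (Suc n)) = (1 - h) *\<^sub>R (u + T v) + h *\<^sub>R T (u + T v)
      + ((1 - h) - h) *\<^sub>R (T (u + T v) - T (u + v))"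
    by (simp only: bn_seq.simps(3) Let_def h prev)
  also have "\<dots> = (1 - h) *\<^sub>R u + h *\<^sub>R T v + T ((1 - h) *\<^sub>R T v + h *\<^sub>R u)"
    by (rule mix)
  finally have "bn_seq \<alpha> T x (Suc (Suc n))
      = rest_part \<alpha> T (Suc n) x + T (move_part \<alpha> T (Suc n) x)"
    by (simp only: uv)
  moreover have "bn_seq \<alpha> T x (Suc n) = rest_part \<alpha> T (Suc n) x + move_part \<alpha> T (Suc n) x"
    unfolding prev uv by (simp add: algebra_simps)
  ultimately show ?case by blast
qed

lemma rest_move_part_diff:
  assumes "linear T"
  shows "rest_part \<alpha> T n (x - y) = rest_part \<alpha> T n x - rest_part \<alpha> T n y
    \<and> move_part \<alpha> T n (x - y) = move_part \<alpha> T n x - move_part \<alpha> T n y"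
  by (induction n) (simp_all add: linear_diff[OF assms] scaleR_diff_right add_diff_add)

lemma rest_move_part_commute:
  assumes "linear T"
  shows "rest_part \<alpha> T n (T x) = T (rest_part \<alpha> T n x)
    \<and> move_part \<alpha> T n (T x) = T (move_part \<alpha> T n x)"
  by (induction n) (simp_all add: linear_0[OF assms] linear_add[OF assms] linear_scale[OF assms])

lemma nonexpansive_norm_le:
  assumes "linear T" "nonexpansive T"
  shows "norm (T x) \<le> norm x"
  using assms(2)[unfolded nonexpansive_def, rule_format, of x 0] assms(1) by (simp add: linear_0)

lemma bn_seq_norm_le:
  assumes \<alpha>: "\<alpha> > 0" and T: "linear T" "nonexpansive T"
  shows "norm (bn_seq \<alpha> T x n) \<le> norm x"
proof -
  have "norm (rest_part \<alpha> T n x) + norm (move_part \<alpha> T n x) \<le> norm x"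
  proof (induction n)
    case (Suc n)
    define h where "h = switch_prob \<alpha> (Suc n)"
    have h: "0 \<le> h" "0 \<le> 1 - h"
      using switch_prob_bounds[OF \<alpha>, of "Suc n"] by (simp_all add: h_def)
    define u where "u = rest_part \<alpha> T n x"
    define v where "v = T (move_part \<alpha> T n x)"
    have "norm ((1 - h) *\<^sub>R u + h *\<^sub>R v) \<le> (1 - h) * norm u + h * norm v"
      using norm_triangle_ineq[of "(1 - h) *\<^sub>R u" "h *\<^sub>R v"] h by simp
    moreover have "norm ((1 - h) *\<^sub>R v + h *\<^sub>R u) \<le> (1 - h) * norm v + h * norm u"
      using norm_triangle_ineq[of "(1 - h) *\<^sub>R v" "h *\<^sub>R u"] h by simp
    ultimately have "norm (rest_part \<alpha> T (Suc n) x) + norm (move_part \<alpha> T (Suc n) x)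
        \<le> norm u + norm v"
      by (simp add: h_def u_def v_def algebra_simps)
    also have "\<dots> \<le> norm x"
      using Suc nonexpansive_norm_le[OF T, of "move_part \<alpha> T n x"] by (simp add: u_def v_def)
    finally show ?case .
  qed simp
  moreover have "norm (bn_seq \<alpha> T x n) \<le> norm (rest_part \<alpha> T n x) + norm (move_part \<alpha> T n x)"
    using bn_seq_eq_rest_move[OF \<alpha> T(1)] by (simp add: norm_triangle_ineq)
  ultimately show ?thesis by linarith
qed

definition energy :: "real \<Rightarrow> ('a::real_inner \<Rightarrow> 'a) \<Rightarrow> 'a \<Rightarrow> nat \<Rightarrow> real" where
  "energy \<alpha> T x n = (norm (rest_part \<alpha> T n x))\<^sup>2 + (norm (move_part \<alpha> T n x))\<^sup>2"

text \<open>
  Mixing two vectors with weights \<open>1 - h\<close> and \<open>h\<close> loses energy by strict convexity of the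
  squared norm; \<open>2 h (1 - h) \<ge> h\<close> because \<open>h \<le> 1/2\<close>.
\<close>
lemma energy_descent:
  fixes T :: "'a::real_inner \<Rightarrow> 'a"
  assumes \<alpha>: "\<alpha> > 0" and T: "linear T" "nonexpansive T"
  shows "energy \<alpha> T x (Suc n) \<le> energy \<alpha> T x n
    - switch_prob \<alpha> (Suc n) * (norm (rest_part \<alpha> T n x - T (move_part \<alpha> T n x)))\<^sup>2"
proof -
  define h where "h = switch_prob \<alpha> (Suc n)"
  have h: "0 \<le> h" "h \<le> 1 / 2"
    using switch_prob_bounds[OF \<alpha>, of "Suc n"] by (simp_all add: h_def)
  define u where "u = rest_part \<alpha> T n x"
  define v where "v = T (move_part \<alpha> T n x)"
  have "energy \<alpha> T x (Suc n)
      = (norm ((1 - h) *\<^sub>R u + h *\<^sub>R v))\<^sup>2 + (norm ((1 - h) *\<^sub>R v + h *\<^sub>R u))\<^sup>2"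
    by (simp add: energy_def h_def u_def v_def)
  also have "\<dots> = (norm u)\<^sup>2 + (norm v)\<^sup>2 - 2 * h * (1 - h) * (norm (u - v))\<^sup>2"
    unfolding power2_norm_eq_inner
    by (simp add: inner_add_left inner_add_right inner_diff_left inner_diff_right inner_commute
        algebra_simps)
  also have "\<dots> \<le> (norm u)\<^sup>2 + (norm v)\<^sup>2 - h * (norm (u - v))\<^sup>2"
    using mult_left_mono[of 1 "2 * (1 - h)" h] h mult_right_mono[of h "2 * h * (1 - h)" "(norm (u - v))\<^sup>2"]
    by (simp add: mult.commute mult.left_commute)
  also have "(norm v)\<^sup>2 \<le> (norm (move_part \<alpha> T n x))\<^sup>2"
    unfolding v_def by (intro power_mono nonexpansive_norm_le T norm_ge_zero)
  finally show ?thesis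
    by (simp add: energy_def u_def v_def h_def)
qed

lemma energy_decseq:
  assumes "\<alpha> > 0" "linear T" "nonexpansive T"
  shows "decseq (energy \<alpha> T x)"
proof (rule decseq_SucI)
  fix n
  have "0 \<le> switch_prob \<alpha> (Suc n) * (norm (rest_part \<alpha> T n x - T (move_part \<alpha> T n x)))\<^sup>2"
    using switch_prob_bounds(1)[OF assms(1)] by simp
  with energy_descent[OF assms, of x n] show "energy \<alpha> T x (Suc n) \<le> energy \<alpha> T x n"
    by linarith
qed

text \<open>
  Summing the energy over two consecutive times makes the descent control the gap
  \<open>u - T v\<close> at both of them. The gap at time \<open>n\<close> is, up to the factor \<open>1 - 2 h\<close>, the
  difference \<open>u - v\<close> at time \<open>n + 1\<close>; together with the gap at time \<open>n + 1\<close> it bounds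
  \<open>v - T v\<close>, and then \<open>u - T u\<close>.
\<close>
lemma energy_diff_tendsto_zero:
  fixes T :: "'a::real_inner \<Rightarrow> 'a"
  assumes \<alpha>: "\<alpha> > 0" and T: "linear T" "nonexpansive T"
  shows "energy \<alpha> T (x - T x) \<longlonglongrightarrow> 0"
proof (rule LIMSEQ_I)
  fix r :: real assume r: "0 < r"
  define gap where "gap n = norm (rest_part \<alpha> T n x - T (move_part \<alpha> T n x))" for n
  define h where "h n = switch_prob \<alpha> (Suc n)" for n
  have h: "0 \<le> h n" "h (Suc n) \<le> h n" "h n \<le> 1 / 2" for n
    using switch_prob_bounds[OF \<alpha>] switch_prob_Suc_le[OF \<alpha>] by (simp_all add: h_def)
  have descent: "energy \<alpha> T x (Suc n) \<le> energy \<alpha> T x n - h n * (gap n)\<^sup>2" for n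
    using energy_descent[OF \<alpha> T] by (simp add: gap_def h_def)
  have pair_descent: "energy \<alpha> T x (Suc n) + energy \<alpha> T x (Suc (Suc n))
      \<le> energy \<alpha> T x n + energy \<alpha> T x (Suc n) - h (Suc n) * ((gap n)\<^sup>2 + (gap (Suc n))\<^sup>2)" for n
    using descent[of n] descent[of "Suc n"] mult_right_mono[OF h(2), of "(gap n)\<^sup>2" n]
    by (simp add: distrib_left)
  have div: "\<not> summable (\<lambda>n. h (Suc n))"
    using switch_prob_not_summable[OF \<alpha>] summable_Suc_iff[of h] by (simp add: h_def[abs_def])
  \<comment> \<open>The bounds \<open>4 d\<close> and \<open>2 d\<close> obtained below for the two modes give energy at most \<open>20 d\<^sup>2\<close>.\<close>
  define d where "d = sqrt (r / 21)"
  have d: "0 < d" "21 * d\<^sup>2 = r" using r by (simp_all add: d_def)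
  obtain n where "(gap n)\<^sup>2 + (gap (Suc n))\<^sup>2 < d\<^sup>2"
    using descent_small_infinitely_often[of 0, OF pair_descent _ h(1) div, of "d\<^sup>2"] d
    by (auto simp: energy_def)
  then have "(gap n)\<^sup>2 < d\<^sup>2" "(gap (Suc n))\<^sup>2 < d\<^sup>2"
    using zero_le_power2[of "gap n"] zero_le_power2[of "gap (Suc n)"] by linarith+
  then have gap: "gap n \<le> d" "gap (Suc n) \<le> d"
    using d(1) power2_less_imp_less[of _ d] by (auto intro: less_imp_le)
  define u where "u = rest_part \<alpha> T (Suc n) x"
  define v where "v = move_part \<alpha> T (Suc n) x"
  have "u - v = (1 - 2 * h n) *\<^sub>R (rest_part \<alpha> T n x - T (move_part \<alpha> T n x))"
    by (simp add: u_def v_def h_def algebra_simps scaleR_2[symmetric])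
  then have "norm (u - v) = (1 - 2 * h n) * gap n"
    using h(3)[of n] by (simp add: gap_def)
  also have "\<dots> \<le> 1 * gap n"
    using h(1)[of n] by (intro mult_right_mono) (auto simp: gap_def)
  finally have uv: "norm (u - v) \<le> d" using gap by simp
  have uTv: "norm (u - T v) \<le> d" using gap(2) by (simp add: gap_def u_def v_def)
  have "norm (v - T v) = norm ((u - T v) - (u - v))" by simp
  also have "\<dots> \<le> d + d"
    using norm_triangle_ineq4[of "u - T v" "u - v"] uv uTv by linarith
  finally have v: "norm (v - T v) \<le> 2 * d" by simp
  have "norm (u - T u) = norm ((u - v) - T (u - v) + (v - T v))"
    using T(1) by (simp add: linear_diff)
  also have "\<dots> \<le> norm (u - v) + norm (T (u - v)) + norm (v - T v)"
    by (meson norm_triangle_ineq norm_triangle_ineq4 add_mono order_refl order_trans)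
  also have "\<dots> \<le> 4 * d"
    using uv v nonexpansive_norm_le[OF T, of "u - v"] by linarith
  finally have u: "norm (u - T u) \<le> 4 * d" .
  have "energy \<alpha> T (x - T x) (Suc n) = (norm (u - T u))\<^sup>2 + (norm (v - T v))\<^sup>2"
    by (simp only: energy_def u_def v_def rest_move_part_diff[OF T(1)]
        rest_move_part_commute[OF T(1)])
  also have "\<dots> \<le> (4 * d)\<^sup>2 + (2 * d)\<^sup>2"
    using u v d(1) by (intro add_mono power_mono) auto
  also have "\<dots> = 20 * d\<^sup>2" by (simp add: power_mult_distrib)
  also have "\<dots> < r" using d(2) zero_less_power[OF d(1), of 2] by linarith
  finally have small: "energy \<alpha> T (x - T x) (Suc n) < r" .
  have "norm (energy \<alpha> T (x - T x) m - 0) < r" if "m \<ge> Suc n" for m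
    using decseqD[OF energy_decseq[OF \<alpha> T] that, of "x - T x"] small by (simp add: energy_def)
  then show "\<exists>no. \<forall>m\<ge>no. norm (energy \<alpha> T (x - T x) m - 0) < r" by blast
qed

lemma bn_seq_diff_tendsto_zero:
  fixes T :: "'a::real_inner \<Rightarrow> 'a"
  assumes \<alpha>: "\<alpha> > 0" and T: "linear T" "nonexpansive T"
  shows "bn_seq \<alpha> T (x - T x) \<longlonglongrightarrow> 0"
proof -
  have "(\<lambda>n. 2 * sqrt (energy \<alpha> T (x - T x) n)) \<longlonglongrightarrow> 2 * sqrt 0"
    by (intro tendsto_intros energy_diff_tendsto_zero assms)
  then have "(\<lambda>n. 2 * sqrt (energy \<alpha> T (x - T x) n)) \<longlonglongrightarrow> 0" by simp
  moreover have "norm (bn_seq \<alpha> T y n) \<le> 2 * sqrt (energy \<alpha> T y n)" for y n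
  proof -
    have "norm (rest_part \<alpha> T n y) \<le> sqrt (energy \<alpha> T y n)"
      "norm (move_part \<alpha> T n y) \<le> sqrt (energy \<alpha> T y n)"
      by (auto simp: energy_def intro: real_le_rsqrt)
    then show ?thesis
      using bn_seq_eq_rest_move[OF \<alpha> T(1), of y n]
        norm_triangle_ineq[of "rest_part \<alpha> T n y" "move_part \<alpha> T n y"] by simp
  qed
  ultimately show ?thesis
    by (intro Lim_null_comparison[where f = "bn_seq \<alpha> T (x - T x)"] always_eventually allI)
qed

section \<open>Ergodic splitting of the Hilbert space\<close>

lemma linear_coefficient_eq_0:
  fixes a b :: real
  assumes "\<And>t. 0 \<le> 2 * t * a + t\<^sup>2 * b"
  shows "a = 0"
proof (rule ccontr)
  assume "a \<noteq> 0"
  define B where "B = \<bar>b\<bar> + 1"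
  have B: "B > 0" "b < B" by (auto simp: B_def)
  have "2 * (- a / B) * a + (- a / B)\<^sup>2 * b = (a\<^sup>2 / B) * (b / B - 2)"
    using B by (simp add: field_simps power2_eq_square)
  moreover have "a\<^sup>2 / B > 0" using \<open>a \<noteq> 0\<close> B by simp
  moreover have "b / B - 2 < 0" using B by (simp add: field_simps)
  ultimately show False
    using assms[of "- a / B"] mult_pos_neg[of "a\<^sup>2 / B" "b / B - 2"] by linarith
qed

text \<open>
  Projection theorem: by the parallelogram law, a sequence in \<open>S\<close> that minimizes the
  distance to \<open>x\<close> is Cauchy, and its limit satisfies the first-order condition.
\<close>
lemma orthogonal_decomposition:
  fixes S :: "'a::{real_inner,complete_space} set"
  assumes S: "subspace S"
  obtains q where "q \<in> closure S" "\<And>s. s \<in> S \<Longrightarrow> orthogonal (x - q) s"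
proof -
  define d where "d = (INF s\<in>S. (norm (x - s))\<^sup>2)"
  have S0: "S \<noteq> {}" using subspace_0[OF S] by auto
  have bdd: "bdd_below ((\<lambda>s. (norm (x - s))\<^sup>2) ` S)"
    by (rule bdd_belowI[of _ 0]) auto
  have d_le: "d \<le> (norm (x - s))\<^sup>2" if "s \<in> S" for s
    unfolding d_def using bdd that by (rule cINF_lower)
  have "\<exists>s\<in>S. (norm (x - s))\<^sup>2 < d + inverse (real (Suc n))" for n
    using cINF_less_iff[OF S0 bdd, of "d + inverse (real (Suc n))"] unfolding d_def[symmetric] by simp
  then obtain m where m: "m n \<in> S" "(norm (x - m n))\<^sup>2 < d + inverse (real (Suc n))" for n
    by metis
  have close: "(norm (m i - m j))\<^sup>2 \<le> 2 * inverse (real (Suc i)) + 2 * inverse (real (Suc j))" for i j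
  proof -
    define mid where "mid = (1 / 2) *\<^sub>R (m i + m j)"
    have "mid \<in> S"
      unfolding mid_def by (intro subspace_scale subspace_add S m)
    have mid: "m i + m j = 2 *\<^sub>R mid" by (simp add: mid_def)
    have "4 * (norm (x - mid))\<^sup>2 = (norm (2 *\<^sub>R x - (m i + m j)))\<^sup>2"
      unfolding mid scaleR_right_diff_distrib[symmetric] by (simp add: power_mult_distrib)
    then have "(norm (m i - m j))\<^sup>2
        = 2 * (norm (x - m i))\<^sup>2 + 2 * (norm (x - m j))\<^sup>2 - 4 * (norm (x - mid))\<^sup>2"
      unfolding power2_norm_eq_inner
      by (simp add: inner_add_left inner_add_right inner_diff_left inner_diff_right inner_commute)
    with m(2)[of i] m(2)[of j] d_le[OF \<open>mid \<in> S\<close>] show ?thesis by linarith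
  qed
  have "Cauchy m"
  proof (rule metric_CauchyI)
    fix e :: real assume "0 < e"
    then obtain N where N: "inverse (real (Suc N)) < e\<^sup>2 / 4"
      using reals_Archimedean[of "e\<^sup>2 / 4"] by auto
    have inv: "inverse (real (Suc i)) < e\<^sup>2 / 4" if "i \<ge> N" for i
    proof -
      have "inverse (real (Suc i)) \<le> inverse (real (Suc N))"
        using that by (intro le_imp_inverse_le) auto
      with N show ?thesis by linarith
    qed
    have "dist (m i) (m j) < e" if "i \<ge> N" "j \<ge> N" for i j
    proof (rule power2_less_imp_less)
      show "(dist (m i) (m j))\<^sup>2 < e\<^sup>2"
        using close[of i j] inv[OF that(1)] inv[OF that(2)] by (simp add: dist_norm)
    qed (use \<open>0 < e\<close> in simp)
    then show "\<exists>M. \<forall>i\<ge>M. \<forall>j\<ge>M. dist (m i) (m j) < e" by blast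
  qed
  then obtain q where q: "m \<longlonglongrightarrow> q"
    using Cauchy_convergent convergent_def by blast
  have "(norm (x - q))\<^sup>2 \<le> d"
  proof (rule LIMSEQ_le)
    show "(\<lambda>n. (norm (x - m n))\<^sup>2) \<longlonglongrightarrow> (norm (x - q))\<^sup>2" by (intro tendsto_intros q)
    show "(\<lambda>n. d + inverse (real (Suc n))) \<longlonglongrightarrow> d"
      by (rule LIMSEQ_inverse_real_of_nat_add)
    show "\<exists>N. \<forall>n\<ge>N. (norm (x - m n))\<^sup>2 \<le> d + inverse (real (Suc n))"
      using m(2) by (auto intro: less_imp_le)
  qed
  have "inner (x - q) s = 0" if s: "s \<in> S" for s
  proof (rule linear_coefficient_eq_0)
    fix t :: real
    have "d \<le> (norm (x - q + t *\<^sub>R s))\<^sup>2"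
    proof (rule LIMSEQ_le_const)
      show "(\<lambda>n. (norm (x - m n + t *\<^sub>R s))\<^sup>2) \<longlonglongrightarrow> (norm (x - q + t *\<^sub>R s))\<^sup>2"
        by (intro tendsto_intros q)
      have "d \<le> (norm (x - (m n - t *\<^sub>R s)))\<^sup>2" for n
        by (intro d_le subspace_diff subspace_scale S m s)
      then show "\<exists>N. \<forall>n\<ge>N. d \<le> (norm (x - m n + t *\<^sub>R s))\<^sup>2"
        by (simp add: algebra_simps)
    qed
    with \<open>(norm (x - q))\<^sup>2 \<le> d\<close> have "(norm (x - q))\<^sup>2 \<le> (norm (x - q + t *\<^sub>R s))\<^sup>2"
      by linarith
    also have "\<dots> = (norm (x - q))\<^sup>2 + (2 * t * inner (x - q) s + t\<^sup>2 * (norm s)\<^sup>2)"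
      unfolding power2_norm_eq_inner
      by (simp add: inner_add_left inner_add_right inner_commute power2_eq_square)
    finally show "0 \<le> 2 * t * inner (x - q) s + t\<^sup>2 * (norm s)\<^sup>2" by simp
  qed
  moreover have "q \<in> closure S"
    using m(1) q by (auto simp: closure_sequential)
  ultimately show ?thesis
    by (intro that) (auto simp: orthogonal_def)
qed

text \<open>
  A fixed point of a linear nonexpansive map is also fixed by the adjoint. Without the adjoint:
  \<open>\<parallel>s + t T y\<parallel> = \<parallel>T (s + t y)\<parallel> \<le> \<parallel>s + t y\<parallel>\<close> for all \<open>t\<close>, so the terms linear in \<open>t\<close> agree.
\<close>
lemma fixed_point_orthogonal_range:
  fixes T :: "'a::real_inner \<Rightarrow> 'a"
  assumes T: "linear T" "nonexpansive T" and s: "T s = s"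
  shows "inner s (y - T y) = 0"
proof (rule linear_coefficient_eq_0)
  fix t :: real
  have "(norm (s + t *\<^sub>R T y))\<^sup>2 = (norm (T (s + t *\<^sub>R y)))\<^sup>2"
    using T(1) s by (simp add: linear_add linear_scale)
  also have "\<dots> \<le> (norm (s + t *\<^sub>R y))\<^sup>2"
    by (intro power_mono nonexpansive_norm_le T norm_ge_zero)
  finally have "0 \<le> (norm (s + t *\<^sub>R y))\<^sup>2 - (norm (s + t *\<^sub>R T y))\<^sup>2" by simp
  also have "\<dots> = 2 * t * inner s (y - T y) + t\<^sup>2 * ((norm y)\<^sup>2 - (norm (T y))\<^sup>2)"
    unfolding power2_norm_eq_inner
    by (simp add: inner_add_left inner_add_right inner_diff_right inner_commute power2_eq_square
        algebra_simps)
  finally show "0 \<le> 2 * t * inner s (y - T y) + t\<^sup>2 * ((norm y)\<^sup>2 - (norm (T y))\<^sup>2)" .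
qed

lemma ergodic_splitting:
  fixes T :: "'a::{real_inner,complete_space} \<Rightarrow> 'a"
  assumes T: "linear T" "nonexpansive T"
  obtains p where "T p = p" "x - p \<in> closure (range (\<lambda>y. y - T y))"
    "orthogonal_projection (fixed_points T) x = p"
proof -
  have "subspace (range (\<lambda>y. y - T y))"
    by (intro linear_subspace_image linear_compose_sub T linear_ident subspace_UNIV)
  then obtain q where q: "q \<in> closure (range (\<lambda>y. y - T y))"
    and orth: "\<And>s. s \<in> range (\<lambda>y. y - T y) \<Longrightarrow> orthogonal (x - q) s"
    using orthogonal_decomposition[of "range (\<lambda>y. y - T y)" x] by blast
  define p where "p = x - q"
  have "inner p (p - T p) = 0"
    using orth by (auto simp: p_def orthogonal_def)
  then have "(norm (p - T p))\<^sup>2 = (norm (T p))\<^sup>2 - (norm p)\<^sup>2"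
    unfolding power2_norm_eq_inner by (simp add: inner_diff_left inner_diff_right inner_commute)
  also have "\<dots> \<le> 0"
    using nonexpansive_norm_le[OF T, of p] by (simp add: power_mono)
  finally have Tp: "T p = p" by simp
  moreover have "orthogonal_projection (fixed_points T) x = p"
  proof (rule orthogonal_projection_eqI)
    show "subspace (fixed_points T)"
      using T(1) by (auto simp: fixed_points_def subspace_def linear_0 linear_add linear_scale)
    show "p \<in> fixed_points T" using Tp by (simp add: fixed_points_def)
    fix s assume "s \<in> fixed_points T"
    then have s: "T s = s" by (simp add: fixed_points_def)
    obtain m where m: "m n \<in> range (\<lambda>y. y - T y)" "m \<longlonglongrightarrow> q" for n
      using q by (auto simp: closure_sequential)
    have "inner s (m n) = 0" for n
      using m(1)[of n] fixed_point_orthogonal_range[OF T s] by auto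
    moreover have "(\<lambda>n. inner s (m n)) \<longlonglongrightarrow> inner s q"
      by (intro tendsto_intros m)
    ultimately have "inner s q = 0"
      by (simp add: LIMSEQ_const_iff)
    then show "orthogonal (x - p) s"
      by (simp add: p_def orthogonal_def inner_commute)
  qed
  ultimately show ?thesis
    using q by (intro that[of p]) (simp_all add: p_def)
qed

lemma bn_seq_fixed_point:
  assumes "T p = p"
  shows "bn_seq \<alpha> T p n = p"
  using assms by (induction \<alpha> T p n rule: bn_seq.induct) (auto simp: Let_def algebra_simps)

text \<open>
  As the iterates do not increase norms, convergence to zero extends from the range of
  \<open>I - T\<close> to its closure.
\<close>
lemma bn_seq_tendsto_projection:
  fixes T :: "'a::{real_inner,complete_space} \<Rightarrow> 'a"
  assumes \<alpha>: "\<alpha> > 0" and T: "linear T" "nonexpansive T"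
  shows "bn_seq \<alpha> T x \<longlonglongrightarrow> orthogonal_projection (fixed_points T) x"
proof -
  obtain p where Tp: "T p = p" and cl: "x - p \<in> closure (range (\<lambda>y. y - T y))"
    and proj: "orthogonal_projection (fixed_points T) x = p"
    using ergodic_splitting[OF T] by blast
  have diff: "bn_seq \<alpha> T (y - z) n = bn_seq \<alpha> T y n - bn_seq \<alpha> T z n" for y z n
    using bn_seq_eq_rest_move[OF \<alpha> T(1), of _ n] rest_move_part_diff[OF T(1), of \<alpha> n y z] by simp
  have "bn_seq \<alpha> T x \<longlonglongrightarrow> p"
  proof (rule LIMSEQ_I)
    fix r :: real assume "0 < r"
    then obtain y where y: "norm (x - p - (y - T y)) < r / 2"
      using cl[unfolded closure_approachable, rule_format, of "r / 2"]
      by (auto simp: dist_norm norm_minus_commute)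
    obtain N where N: "norm (bn_seq \<alpha> T (y - T y) n) < r / 2" if "n \<ge> N" for n
      using LIMSEQ_D[OF bn_seq_diff_tendsto_zero[OF assms, of y], of "r / 2"] \<open>0 < r\<close> by auto
    have "norm (bn_seq \<alpha> T x n - p) < r" if "n \<ge> N" for n
    proof -
      have "bn_seq \<alpha> T x n - p
          = bn_seq \<alpha> T (x - p - (y - T y)) n + bn_seq \<alpha> T (y - T y) n"
        by (simp add: diff bn_seq_fixed_point[of T p, OF Tp])
      also have "norm \<dots> \<le> norm (x - p - (y - T y)) + norm (bn_seq \<alpha> T (y - T y) n)"
        using bn_seq_norm_le[OF assms] norm_triangle_mono order_refl by blast
      also have "\<dots> < r" using y N[OF that] by linarith
      finally show ?thesis .
    qed
    then show "\<exists>no. \<forall>n\<ge>no. norm (bn_seq \<alpha> T x n - p) < r" by blast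
  qed
  then show ?thesis by (simp add: proj)
qed

theorem theorem4p5:
  fixes \<alpha> :: real
    and T :: "'a::{real_inner,complete_space} \<Rightarrow> 'a"
    and x0 :: 'a
  assumes "\<alpha> > 2"
    and "linear T"
    and "nonexpansive T"
  shows "regular_matrix (bn_coeff \<alpha>) \<and>
    weakly_converges (bn_seq \<alpha> T x0) (orthogonal_projection (fixed_points T) x0)"
proof
  have \<alpha>: "\<alpha> > 0" using assms(1) by simp
  show "regular_matrix (bn_coeff \<alpha>)"
    by (intro regular_matrix_if_stochastic bn_coeff_eq_0 bn_coeff_nonneg bn_coeff_row_sum
        bn_coeff_column_tendsto_zero \<alpha>)
  show "weakly_converges (bn_seq \<alpha> T x0) (orthogonal_projection (fixed_points T) x0)"
    unfolding weakly_converges_def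
    by (intro allI tendsto_inner bn_seq_tendsto_projection tendsto_const \<alpha> assms)
qed

end
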